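(* For $k=1,2$ let $a_k\in\mathbb D$, $0\le\gamma_k<2\pi$, $a_k'=|1+a_k|-1$, $\gamma_{a_k}=\arg(1+\overline{a_k})$, and let $f_k=h_k+\overline{g_k}\in\mathcal S(H^{a_k}_{\gamma_k})$ satisfy $h_k(z)+e^{-2i(\gamma_k+\gamma_{a_k})}g_k(z)=\frac{(1+a_k')z}{1-e^{i(\gamma_k+\gamma_{a_k})}z}$. If $f_1*f_2$ is locally univalent in $\mathbb D$, then $f_1*f_2$ is univalent and convex in the direction $-\Gamma$, where $\Gamma=\gamma_1+\gamma_2+\gamma_{a_1}+\gamma_{a_2}$.
   Context: $\mathbb D$ is the open unit disk. Harmonic $f=h+\overline g$ on $\mathbb D$ ($h,g$ analytic, $g(0)=0$); $\mathcal H$: those with $h(0)=g(0)=0$, $h'(0)=1$; $\mathcal S_H$: sense-preserving ($|h'|>|g'|$) univalent members of $\mathcal H$. $H^a_\gamma=\{w:\mathrm{Re}(\frac{e^{i\gamma}}{1+a}w)>-\frac12\}$, $\mathcal S(H^a_\gamma)=\{f\in\mathcal S_H:f(\mathbb D)=H^a_\gamma\}$. Harmonic convolution: $f*F=\sum a_nA_nz^n+\sum\overline{b_nB_n}\,\overline z^n$ for $f=\sum a_nz^n+\sum\overline{b_n}\,\overline z^n$, $F=\sum A_nz^n+\sum\overline{B_n}\,\overline z^n$. A univalent map $f$ is convex in the direction $\alpha$ (modulo $\pi$) if each line parallel to the line through $0$ and $e^{i\alpha}$ meets $f(\mathbb D)$ in an interval or the empty set. *)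

theory Defs
  imports "HOL-Analysis.Analysis"
begin

abbreviation unit_disk :: "complex set" where "unit_disk \<equiv> ball 0 1"

definition harm :: "(complex \<Rightarrow> complex) \<Rightarrow> (complex \<Rightarrow> complex) \<Rightarrow> complex \<Rightarrow> complex" where
  "harm h g z = h z + cnj (g z)"

definition in_S_H :: "(complex \<Rightarrow> complex) \<Rightarrow> (complex \<Rightarrow> complex) \<Rightarrow> bool" where
  "in_S_H h g \<longleftrightarrow> h holomorphic_on unit_disk \<and> g holomorphic_on unit_disk \<and>
     h 0 = 0 \<and> g 0 = 0 \<and> deriv h 0 = 1 \<and>
     (\<forall>z\<in>unit_disk. norm (deriv g z) < norm (deriv h z)) \<and>
     inj_on (harm h g) unit_disk"

definition half_plane :: "complex \<Rightarrow> real \<Rightarrow> complex set" where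
  "half_plane a \<gamma> = {w. Re (exp (\<i> * of_real \<gamma>) / (1 + a) * w) > - 1/2}"

definition in_S_half_plane :: "complex \<Rightarrow> real \<Rightarrow> (complex \<Rightarrow> complex) \<Rightarrow> (complex \<Rightarrow> complex) \<Rightarrow> bool" where
  "in_S_half_plane a \<gamma> h g \<longleftrightarrow> in_S_H h g \<and> harm h g ` unit_disk = half_plane a \<gamma>"

definition taylor_coeff :: "(complex \<Rightarrow> complex) \<Rightarrow> nat \<Rightarrow> complex" where
  "taylor_coeff h n = (deriv ^^ n) h 0 / of_nat (fact n)"

definition hadamard :: "(complex \<Rightarrow> complex) \<Rightarrow> (complex \<Rightarrow> complex) \<Rightarrow> complex \<Rightarrow> complex" where
  "hadamard h1 h2 z = (\<Sum>n. taylor_coeff h1 n * taylor_coeff h2 n * z ^ n)"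

definition harm_conv :: "(complex \<Rightarrow> complex) \<Rightarrow> (complex \<Rightarrow> complex) \<Rightarrow>
    (complex \<Rightarrow> complex) \<Rightarrow> (complex \<Rightarrow> complex) \<Rightarrow> complex \<Rightarrow> complex" where
  "harm_conv h1 g1 h2 g2 = harm (hadamard h1 h2) (hadamard g1 g2)"

definition locally_univalent :: "(complex \<Rightarrow> complex) \<Rightarrow> complex set \<Rightarrow> bool" where
  "locally_univalent F S \<longleftrightarrow> (\<forall>z\<in>S. \<exists>r>0. inj_on F (ball z r \<inter> S))"

definition convex_in_direction :: "real \<Rightarrow> complex set \<Rightarrow> bool" where
  "convex_in_direction \<alpha> S \<longleftrightarrow>
     (\<forall>w. convex (S \<inter> {w + of_real t * exp (\<i> * of_real \<alpha>) | t. True}))"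

end

theory Submission
  imports Defs "HOL-Complex_Analysis.Conformal_Mappings"
begin

text \<open>
  Put \<open>E = exp (\<i> \<Gamma>)\<close> and \<open>F \<zeta> = E f (z / E)\<close> with \<open>z = \<zeta> / (1 + \<zeta>)\<close>, where \<open>f = f1 * f2\<close>; here \<open>\<zeta>\<close>
  ranges over the half-plane \<open>Re \<zeta> > -1/2\<close>. The shear equations for \<open>f1\<close>, \<open>f2\<close> give a holomorphic
  \<open>\<Phi>\<close> with \<open>Im F = Im \<Phi>\<close> and \<open>Re \<Phi>' > 0\<close>. Hence \<open>Im F\<close> increases strictly on vertical lines, and
  each level set \<open>Im F = y\<close> is the graph of a continuous function over a set of abscissae. That
  set is an interval: if a vertical line strictly between two points of the level set missed it, say
  with \<open>Im \<Phi> < y\<close> there, then \<open>Im \<Phi>'\<close> would vary by a fixed amount along all sufficiently high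
  horizontal segments between the two points, so by the Schwarz-Pick and Harnack inequalities
  \<open>Re \<Phi>'\<close> would be bounded below on the upper part of the line and \<open>Im \<Phi>\<close> would be unbounded there.
  On a level curve \<open>Re F\<close> is continuous and locally injective, hence injective, and its image is an
  interval; so \<open>F\<close> is injective and its image is convex in the horizontal direction.
\<close>

section \<open>Estimates for functions with positive real part\<close>

text \<open>Schwarz-Pick for the right half-plane: \<open>p\<close>, rescaled to the unit disk and
  followed by the Cayley transform sending \<open>p z\<close> to 0, is a self-map of the disk fixing
  0, so the Schwarz lemma bounds its derivative there.\<close>

lemma norm_deriv_le_of_Re_pos:
  assumes holp: "p holomorphic_on ball z d" and "0 < d"
    and pos: "\<And>w. w \<in> ball z d \<Longrightarrow> 0 < Re (p w)"
  shows "norm (deriv p z) \<le> 2 * Re (p z) / d"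
proof -
  define a where "a = p z"
  have a: "0 < Re a" using pos[of z] \<open>0 < d\<close> by (simp add: a_def)
  define q where "q w = (p (z + d * w) - a) / (p (z + d * w) + cnj a)" for w :: complex
  have inb: "z + d * w \<in> ball z d" if "norm w < 1" for w :: complex
    using that \<open>0 < d\<close> by (simp add: dist_norm norm_mult)
  have nz: "p (z + d * w) + cnj a \<noteq> 0" if "norm w < 1" for w :: complex
  proof -
    have "0 < Re (p (z + d * w) + cnj a)" using pos[OF inb[OF that]] a by simp
    thus ?thesis by (metis less_irrefl zero_complex.simps(1))
  qed
  have holc: "(\<lambda>w. p (z + d * w)) holomorphic_on ball 0 1"
    by (rule holomorphic_on_compose_gen[OF _ holp, unfolded o_def])
       (use inb in \<open>auto intro!: holomorphic_intros\<close>)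
  have holq: "q holomorphic_on ball 0 1"
    unfolding q_def using nz by (intro holomorphic_intros holc) auto
  have q0: "q 0 = 0" by (simp add: q_def a_def)
  have q1: "norm (q w) < 1" if "norm w < 1" for w :: complex
  proof -
    let ?b = "p (z + d * w)"
    have "0 < Re ?b" using pos[OF inb[OF that]] .
    \<comment> \<open>The squared norms differ by \<open>4 * Re a * Re ?b\<close>.\<close>
    have "(norm (?b - a))\<^sup>2 < (norm (?b + cnj a))\<^sup>2"
      unfolding cmod_power2 using mult_pos_pos[OF \<open>0 < Re ?b\<close> a]
      by (simp add: power2_eq_square algebra_simps)
    hence "norm (?b - a) < norm (?b + cnj a)" using power_less_imp_less_base norm_ge_zero by blast
    thus ?thesis unfolding q_def norm_divide using nz[OF that] by simp
  qed
  have dq: "norm (deriv q 0) \<le> 1"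
    using Schwarz_Lemma(2)[OF holq q0, of 0] q1 by simp
  have "(p has_field_derivative deriv p z) (at z)"
    using holp \<open>0 < d\<close> by (intro holomorphic_derivI[of _ "ball z d"]) auto
  hence dp: "((\<lambda>w. p (z + d * w)) has_field_derivative deriv p z * d) (at 0)"
    by (intro DERIV_chain2[of p]) (auto intro!: derivative_eq_intros)
  have sum: "a + cnj a = of_real (2 * Re a)" by (simp add: complex_eq_iff)
  \<comment> \<open>The numerator of \<open>q\<close> vanishes at 0, so only its derivative survives
    the quotient rule, over the denominator \<open>a + cnj a\<close>.\<close>
  have "(q has_field_derivative (deriv p z * d / (2 * Re a))) (at 0)"
    unfolding q_def
    apply (rule derivative_eq_intros dp refl)+
    using a sum by (auto simp: a_def[symmetric] field_simps)
  hence "deriv q 0 = deriv p z * d / (2 * Re a)" by (rule DERIV_imp_deriv)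
  hence "norm (deriv q 0) = norm (deriv p z) * d / (2 * Re a)"
    using a \<open>0 < d\<close> by (simp add: norm_divide norm_mult)
  hence "norm (deriv p z) * d / (2 * Re a) \<le> 1" using dq by simp
  thus ?thesis using a \<open>0 < d\<close> by (simp add: a_def[symmetric] field_simps)
qed

text \<open>Harnack-type comparison: the bound on \<open>r'\<close> makes \<open>ln r\<close>
  Lipschitz with constant \<open>K\<close>; exponentiate.\<close>

lemma le_mult_exp_of_abs_deriv_le:
  fixes r :: "real \<Rightarrow> real"
  assumes der: "\<And>t. t \<in> {a..b} \<Longrightarrow> (r has_real_derivative r' t) (at t)"
    and pos: "\<And>t. t \<in> {a..b} \<Longrightarrow> 0 < r t"
    and bd: "\<And>t. t \<in> {a..b} \<Longrightarrow> \<bar>r' t\<bar> \<le> K * r t"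
    and s: "s \<in> {a..b}" and t: "t \<in> {a..b}"
  shows "r s \<le> r t * exp (K * \<bar>s - t\<bar>)"
proof -
  have "norm (ln (r s) - ln (r t)) \<le> K * norm (s - t)"
  proof (rule field_differentiable_bound[of "{a..b}" "\<lambda>t. ln (r t)" "\<lambda>t. r' t / r t" K])
    fix u assume u: "u \<in> {a..b}"
    show "((\<lambda>t. ln (r t)) has_field_derivative r' u / r u) (at u within {a..b})"
      using pos[OF u] by (auto intro!: derivative_eq_intros has_field_derivative_at_within[OF der[OF u]])
    show "norm (r' u / r u) \<le> K" using pos[OF u] bd[OF u] by (simp add: field_simps)
  qed (use s t in auto)
  hence "ln (r s) \<le> ln (r t) + K * \<bar>s - t\<bar>" by auto
  hence "exp (ln (r s)) \<le> exp (ln (r t) + K * \<bar>s - t\<bar>)" by simp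
  thus ?thesis using pos[OF s] pos[OF t] by (simp add: exp_add)
qed

section \<open>Values of \<open>Im \<Phi>\<close> along horizontal and vertical lines\<close>

lemma has_vector_derivative_horizontal:
  assumes "(f has_field_derivative D) (at (Complex x y))"
  shows "((\<lambda>t. f (Complex t y)) has_vector_derivative D) (at x)"
proof -
  have "((\<lambda>t. Complex t y) has_vector_derivative 1) (at x)"
    unfolding Complex_eq by (auto intro!: derivative_eq_intros)
  from field_vector_diff_chain_at[OF this assms] show ?thesis by (simp add: o_def)
qed

lemma has_vector_derivative_vertical:
  assumes "(f has_field_derivative D) (at (Complex x y))"
  shows "((\<lambda>t. f (Complex x t)) has_vector_derivative \<i> * D) (at y)"
proof -
  have "((\<lambda>t. Complex x t) has_vector_derivative \<i>) (at y)"
    unfolding Complex_eq by (auto intro!: derivative_eq_intros)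
  from field_vector_diff_chain_at[OF this assms] show ?thesis by (simp add: o_def)
qed

text \<open>One half of the intermediate value argument; a conjugate reflection will supply the
  other. A line staying below \<open>y\<close> would have \<open>Re (deriv \<Phi>)\<close> at least
  a fixed \<open>\<delta>\<close> high up, and \<open>Im \<Phi>\<close> would reach \<open>y\<close>
  after all.\<close>

lemma Im_ge_on_intermediate_line:
  assumes hol: "\<Phi> holomorphic_on {z. c < Re z}"
    and pos: "\<And>z. c < Re z \<Longrightarrow> 0 < Re (deriv \<Phi> z)"
    and x: "c < x1" "x1 < x" "x < x2"
    and y1: "y \<le> Im (\<Phi> (Complex x1 v1))" and y2: "y \<le> Im (\<Phi> (Complex x2 v2))"
  shows "\<exists>v. y \<le> Im (\<Phi> (Complex x v))"
proof (rule ccontr)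
  assume "\<not> ?thesis"
  hence less: "Im (\<Phi> (Complex x v)) < y" for v by (meson not_le)
  define p where "p = deriv \<Phi>"
  define u where "u s v = Im (\<Phi> (Complex s v))" for s v
  have op: "open {z. c < Re z}" by (rule open_halfspace_Re_gt)
  have holp: "p holomorphic_on {z. c < Re z}"
    unfolding p_def using holomorphic_deriv[OF hol op] .
  have d\<Phi>: "(\<Phi> has_field_derivative p z) (at z)" if "c < Re z" for z
    unfolding p_def using holomorphic_derivI[OF hol op, of z] that by simp
  have dp: "(p has_field_derivative deriv p z) (at z)" if "c < Re z" for z
    using holomorphic_derivI[OF holp op, of z] that by simp
  have dux: "((\<lambda>s. u s v) has_real_derivative Im (p (Complex s v))) (at s)" if "c < s" for s v
    unfolding u_def using that
    by (intro has_field_derivative_Im has_vector_derivative_horizontal d\<Phi>) simp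
  have duv: "((\<lambda>v. u s v) has_real_derivative Re (p (Complex s v))) (at v)" if "c < s" for s v
    using has_field_derivative_Im[OF has_vector_derivative_vertical[OF d\<Phi>[of "Complex s v"]]] that
    unfolding u_def by simp
  have p_pos: "0 < Re (p z)" if "c < Re z" for z using pos[OF that] by (simp add: p_def)
  have mono: "u s v < u s w" if "c < s" "v < w" for s v w
    by (rule DERIV_pos_imp_increasing[OF that(2)]) (use duv[OF that(1)] p_pos that(1) in fastforce)
  \<comment> \<open>From height \<open>V\<close> upwards both outer lines exceed level
    \<open>y\<close> by at least \<open>e\<close>, since \<open>Im \<Phi>\<close> increases
    vertically.\<close>
  define V where "V = max v1 v2 + 1"
  define e where "e = min (u x1 V) (u x2 V) - y"
  have "u x1 v1 < u x1 V" "u x2 v2 < u x2 V" using x by (auto intro!: mono simp: V_def)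
  hence e: "0 < e" using y1 y2 by (auto simp: e_def u_def)
  define L where "L = x2 - x1"
  \<comment> \<open>A ball of radius \<open>d\<close> about any point of abscissa at least
    \<open>x1\<close> stays in the half-plane; \<open>K\<close> is the resulting Schwarz-Pick
    constant.\<close>
  define d where "d = x1 - c"
  define K where "K = 2 / d"
  \<comment> \<open>The factors are \<open>1 / K\<close>, a lower bound for
    \<open>norm (deriv p)\<close> at some point between the outer lines, and the Harnack loss over a
    distance of at most \<open>L\<close>.\<close>
  define \<delta> where "\<delta> = d / 2 * (e / L\<^sup>2) * exp (- (K * L))"
  have L: "0 < L" and d: "0 < d" using x by (auto simp: L_def d_def)
  have K: "0 < K" using d by (simp add: K_def)
  have \<delta>: "0 < \<delta>" using e L d by (simp add: \<delta>_def)
  have dp_le: "norm (deriv p (Complex s v)) \<le> K * Re (p (Complex s v))" if "x1 \<le> s" for s v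
  proof -
    have ss: "ball (Complex s v) d \<subseteq> {z. c < Re z}"
    proof
      fix w assume "w \<in> ball (Complex s v) d"
      hence "\<bar>Re (Complex s v - w)\<bar> < d"
        by (metis abs_Re_le_cmod dist_norm mem_ball order_le_less_trans)
      thus "w \<in> {z. c < Re z}" using that by (simp add: d_def)
    qed
    have "norm (deriv p (Complex s v)) \<le> 2 * Re (p (Complex s v)) / d"
      by (rule norm_deriv_le_of_Re_pos[OF holomorphic_on_subset[OF holp ss] d]) (use ss p_pos in auto)
    thus ?thesis by (simp add: K_def)
  qed
  have lower: "\<delta> \<le> Re (p (Complex x v))" if v: "V \<le> v" for v
  proof -
    have ge: "y + e \<le> u x1 v" "y + e \<le> u x2 v"
      using mono[of x1 V v] mono[of x2 V v] v x by (auto simp: e_def min_def le_less split: if_splits)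
    have lt: "u x v < y" using less by (simp add: u_def)
    \<comment> \<open>\<open>u\<close> drops by more than \<open>e\<close> from the left line to the
      middle one and rises by more than \<open>e\<close> to the right one, so \<open>Im p\<close> is
      negative at some \<open>\<xi>1\<close> and at least \<open>e / L\<close> at some
      \<open>\<xi>2\<close>.\<close>
    obtain \<xi>1 where \<xi>1: "x1 < \<xi>1" "\<xi>1 < x" "u x v - u x1 v = (x - x1) * Im (p (Complex \<xi>1 v))"
      using MVT2[OF x(2), of "\<lambda>s. u s v" "\<lambda>s. Im (p (Complex s v))"] dux x(1) by force
    obtain \<xi>2 where \<xi>2: "x < \<xi>2" "\<xi>2 < x2" "u x2 v - u x v = (x2 - x) * Im (p (Complex \<xi>2 v))"
      using MVT2[OF x(3), of "\<lambda>s. u s v" "\<lambda>s. Im (p (Complex s v))"] dux x(1,2) by force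
    have "(x - x1) * Im (p (Complex \<xi>1 v)) < 0" using \<xi>1 ge lt e by linarith
    hence n1: "Im (p (Complex \<xi>1 v)) < 0" using x(2) by (simp add: mult_less_0_iff)
    have e_le: "e \<le> (x2 - x) * Im (p (Complex \<xi>2 v))" using \<xi>2 ge lt by linarith
    hence "0 < (x2 - x) * Im (p (Complex \<xi>2 v))" using e by linarith
    hence n2: "0 < Im (p (Complex \<xi>2 v))" by (rule zero_less_mult_pos) (use x in simp)
    note e_le
    also have "(x2 - x) * Im (p (Complex \<xi>2 v)) \<le> L * Im (p (Complex \<xi>2 v))"
      using n2 x by (intro mult_right_mono) (auto simp: L_def)
    finally have "e \<le> L * Im (p (Complex \<xi>2 v))" .
    hence n3: "e / L \<le> Im (p (Complex \<xi>2 v))" using L by (simp add: field_simps)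
    have "\<xi>1 < \<xi>2" using \<xi>1 \<xi>2 by simp
    \<comment> \<open>Second mean value step: \<open>Im p\<close> gains at least
      \<open>e / L\<close> over a length of at most \<open>L\<close>, so \<open>deriv p\<close> is
      large at some \<open>\<xi>\<close>, and \<open>dp_le\<close> turns this into a lower bound for
      \<open>Re p\<close> there.\<close>
    have "\<exists>\<xi>. \<xi>1 < \<xi> \<and> \<xi> < \<xi>2 \<and> Im (p (Complex \<xi>2 v)) - Im (p (Complex \<xi>1 v))
        = (\<xi>2 - \<xi>1) * Im (deriv p (Complex \<xi> v))"
      by (rule MVT2[OF \<open>\<xi>1 < \<xi>2\<close>])
         (use \<xi>1 x in \<open>auto intro!: has_field_derivative_Im has_vector_derivative_horizontal dp\<close>)
    then obtain \<xi> where \<xi>: "\<xi>1 < \<xi>" "\<xi> < \<xi>2"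
      "Im (p (Complex \<xi>2 v)) - Im (p (Complex \<xi>1 v)) = (\<xi>2 - \<xi>1) * Im (deriv p (Complex \<xi> v))"
      by blast
    have "e / L \<le> (\<xi>2 - \<xi>1) * Im (deriv p (Complex \<xi> v))" using \<xi>(3) n1 n3 by linarith
    also have "\<dots> \<le> (\<xi>2 - \<xi>1) * norm (deriv p (Complex \<xi> v))"
      using \<open>\<xi>1 < \<xi>2\<close> abs_Im_le_cmod[of "deriv p (Complex \<xi> v)"]
      by (intro mult_left_mono) auto
    also have "\<dots> \<le> L * norm (deriv p (Complex \<xi> v))"
      using \<xi>1 \<xi>2 by (intro mult_right_mono) (auto simp: L_def)
    also have "\<dots> \<le> L * (K * Re (p (Complex \<xi> v)))"
      using dp_le[of \<xi> v] \<xi> \<xi>1 L by (intro mult_left_mono) auto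
    finally have b1: "d / 2 * (e / L\<^sup>2) \<le> Re (p (Complex \<xi> v))"
      using L d by (simp add: K_def field_simps power2_eq_square)
    \<comment> \<open>Harnack along the horizontal segment carries the bound from
      \<open>\<xi>\<close>, which depends on \<open>v\<close>, to the fixed abscissa
      \<open>x\<close>.\<close>
    have "Re (p (Complex \<xi> v)) \<le> Re (p (Complex x v)) * exp (K * \<bar>\<xi> - x\<bar>)"
    proof (rule le_mult_exp_of_abs_deriv_le[of x1 x2 _ "\<lambda>s. Re (deriv p (Complex s v))"])
      fix t assume t: "t \<in> {x1..x2}"
      show "((\<lambda>s. Re (p (Complex s v))) has_real_derivative Re (deriv p (Complex t v))) (at t)"
        using t x by (intro has_field_derivative_Re has_vector_derivative_horizontal dp) simp
      show "0 < Re (p (Complex t v))" using t x by (intro p_pos) simp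
      show "\<bar>Re (deriv p (Complex t v))\<bar> \<le> K * Re (p (Complex t v))"
        using dp_le[of t v] t abs_Re_le_cmod[of "deriv p (Complex t v)"] by simp
    qed (use \<xi> \<xi>1 \<xi>2 x in auto)
    also have "\<dots> \<le> Re (p (Complex x v)) * exp (K * L)"
      using p_pos[of "Complex x v"] x K \<xi> \<xi>1 \<xi>2 by (intro mult_left_mono) (auto simp: L_def)
    finally have "d / 2 * (e / L\<^sup>2) \<le> Re (p (Complex x v)) * exp (K * L)" using b1 by linarith
    hence "d / 2 * (e / L\<^sup>2) * exp (- (K * L)) \<le> Re (p (Complex x v)) * exp (K * L) * exp (- (K * L))"
      by (intro mult_right_mono) auto
    thus ?thesis by (simp add: \<delta>_def mult.assoc exp_minus_inverse)
  qed
  \<comment> \<open>Growing from height \<open>V\<close> at rate at least \<open>\<delta>\<close>,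
    \<open>u x\<close> reaches \<open>y\<close> no later than at \<open>W\<close>.\<close>
  define W where "W = V + (y - u x V) / \<delta>"
  have "V < W" using less[of V] \<delta> by (simp add: W_def u_def)
  then obtain w where w: "V < w" "w < W" "u x W - u x V = (W - V) * Re (p (Complex x w))"
    using MVT2[OF \<open>V < W\<close>, of "\<lambda>v. u x v" "\<lambda>v. Re (p (Complex x v))"] duv[of x] x by force
  have "(W - V) * \<delta> \<le> (W - V) * Re (p (Complex x w))"
    using lower[of w] w by (intro mult_left_mono) auto
  moreover have "(W - V) * \<delta> = y - u x V" using \<delta> by (simp add: W_def)
  ultimately have "y \<le> u x W" using w by linarith
  thus False using less[of W] by (simp add: u_def)
qed

text \<open>The preceding lemma gives a point of the line at or above level \<open>y\<close>, its
  reflected version one at or below; continuity along the line does the rest.\<close>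

lemma ex_Im_eq_on_vertical_line:
  assumes hol: "\<Phi> holomorphic_on {z. c < Re z}"
    and pos: "\<And>z. c < Re z \<Longrightarrow> 0 < Re (deriv \<Phi> z)"
    and x: "c < x1" "x1 < x" "x < x2"
    and y1: "Im (\<Phi> (Complex x1 v1)) = y" and y2: "Im (\<Phi> (Complex x2 v2)) = y"
  shows "\<exists>v. Im (\<Phi> (Complex x v)) = y"
proof -
  have op: "open {z. c < Re z}" by (rule open_halfspace_Re_gt)
  obtain w1 where w1: "y \<le> Im (\<Phi> (Complex x w1))"
    using Im_ge_on_intermediate_line[OF hol pos x, of y v1 v2] y1 y2 by auto
  \<comment> \<open>\<open>Im (\<Psi> z) = - Im (\<Phi> (cnj z))\<close>, while the derivative is
    merely conjugated and keeps its positive real part.\<close>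
  define \<Psi> where "\<Psi> = cnj \<circ> \<Phi> \<circ> cnj"
  have d\<Psi>: "(\<Psi> has_field_derivative cnj (deriv \<Phi> (cnj z))) (at z)" if "c < Re z" for z
    unfolding \<Psi>_def by (rule has_field_derivative_cnj_cnj, rule holomorphic_derivI[OF hol op]) (use that in simp)
  have hol\<Psi>: "\<Psi> holomorphic_on {z. c < Re z}"
    unfolding holomorphic_on_open[OF op] using d\<Psi> by blast
  have pos\<Psi>: "0 < Re (deriv \<Psi> z)" if "c < Re z" for z
    using DERIV_imp_deriv[OF d\<Psi>[OF that]] pos[of "cnj z"] that by simp
  have "Complex a (- b) = cnj (Complex a b)" for a b by (simp add: complex_eq_iff)
  hence "- y \<le> Im (\<Psi> (Complex x1 (- v1)))" "- y \<le> Im (\<Psi> (Complex x2 (- v2)))"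
    using y1 y2 by (auto simp: \<Psi>_def)
  from Im_ge_on_intermediate_line[OF hol\<Psi> pos\<Psi> x this] obtain w2 where w2: "- y \<le> Im (\<Psi> (Complex x w2))"
    by blast
  hence w2': "Im (\<Phi> (Complex x (- w2))) \<le> y"
    by (simp add: \<Psi>_def) (simp add: complex_cnj)
  have "continuous_on UNIV (\<lambda>v. Im (\<Phi> (Complex x v)))"
  proof -
    have "continuous_on UNIV (\<lambda>v. \<Phi> (Complex x v))"
      by (rule continuous_on_compose2[OF holomorphic_on_imp_continuous_on[OF hol]])
         (use x in \<open>auto simp: Complex_eq intro!: continuous_intros\<close>)
    thus ?thesis by (intro continuous_intros)
  qed
  hence "connected ((\<lambda>v. Im (\<Phi> (Complex x v))) ` UNIV)"
    by (rule connected_continuous_image) simp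
  hence "y \<in> range (\<lambda>v. Im (\<Phi> (Complex x v)))"
    by (rule connectedD_interval[where x = "Im (\<Phi> (Complex x (- w2)))" and y = "Im (\<Phi> (Complex x w1))"])
       (use w2' w1 in auto)
  thus ?thesis by auto
qed

section \<open>Injectivity and intervals along level curves\<close>

text \<open>Equal values at \<open>a < b\<close> would force an extremum over \<open>{a..b}\<close>
  at an interior point, but near it a continuous injective function is strictly monotone.\<close>

lemma inj_on_interval_of_locally_inj:
  fixes m :: "real \<Rightarrow> real"
  assumes int: "is_interval I" and cont: "continuous_on I m"
    and loc: "\<And>s. s \<in> I \<Longrightarrow> \<exists>e>0. inj_on m (I \<inter> ball s e)"
  shows "inj_on m I"
proof -
  have False if ab: "a \<in> I" "b \<in> I" "a < b" and eq: "m a = m b" for a b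
  proof -
    have sub: "{a..b} \<subseteq> I" using int ab unfolding is_interval_1 by (meson atLeastAtMost_iff subsetI)
    have cab: "continuous_on {a..b} m" by (rule continuous_on_subset[OF cont sub])
    obtain M where M: "M \<in> {a..b}" "\<And>t. t \<in> {a..b} \<Longrightarrow> m t \<le> m M"
      using continuous_attains_sup[OF compact_Icc _ cab] ab by auto
    obtain N where N: "N \<in> {a..b}" "\<And>t. t \<in> {a..b} \<Longrightarrow> m N \<le> m t"
      using continuous_attains_inf[OF compact_Icc _ cab] ab by auto
    \<comment> \<open>If neither extremum found is interior, both equal the common endpoint value;
      then \<open>m\<close> is constant and the midpoint serves.\<close>
    have "\<exists>c\<in>{a<..<b}. (\<forall>t\<in>{a..b}. m t \<le> m c) \<or> (\<forall>t\<in>{a..b}. m c \<le> m t)"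
    proof (cases "M \<in> {a<..<b} \<or> N \<in> {a<..<b}")
      case True
      thus ?thesis using M N by blast
    next
      case False
      hence "M \<in> {a, b}" "N \<in> {a, b}" using M(1) N(1) by auto
      hence "m M = m a" "m N = m a" using eq by auto
      hence const: "m t = m a" if "t \<in> {a..b}" for t
        using M(2)[OF that] N(2)[OF that] by linarith
      have "\<forall>t\<in>{a..b}. m t \<le> m ((a + b) / 2)"
      proof
        fix t assume "t \<in> {a..b}"
        thus "m t \<le> m ((a + b) / 2)" using const[of t] const[of "(a + b) / 2"] ab by simp
      qed
      thus ?thesis using ab by (intro bexI[of _ "(a + b) / 2"]) auto
    qed
    then obtain c where c: "a < c" "c < b"
      "(\<forall>t\<in>{a..b}. m t \<le> m c) \<or> (\<forall>t\<in>{a..b}. m c \<le> m t)" by auto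
    have "c \<in> I" using sub c(1,2) by force
    then obtain e where e: "e > 0" "inj_on m (I \<inter> ball c e)" using loc by blast
    define d where "d = min (e / 2) (min (c - a) (b - c))"
    have d: "0 < d" "d < e" "a \<le> c - d" "c + d \<le> b" using e c by (auto simp: d_def)
    have "{c - d..c + d} \<subseteq> I \<inter> ball c e" using d sub by (auto simp: dist_real_def)
    hence "inj_on m {c - d..c + d}" using e inj_on_subset by blast
    moreover have "continuous_on {c - d..c + d} m"
      by (rule continuous_on_subset[OF cab]) (use d in auto)
    ultimately have "(m (c - d) < m c \<and> m c < m (c + d)) \<or> (m (c + d) < m c \<and> m c < m (c - d))"
      using continuous_inj_imp_mono[of "c - d" c "c + d" m] d by simp
    moreover have "c - d \<in> {a..b}" "c + d \<in> {a..b}" using d c by auto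
    ultimately show False using c(3) by force
  qed
  thus ?thesis by (intro linorder_inj_onI') blast
qed

text \<open>The situation after the change of variable: \<open>F\<close> is the rotated harmonic
  map, tied to a holomorphic \<open>\<Phi>\<close> only through its imaginary part.\<close>

locale vertically_monotone_shear =
  fixes c :: real and \<Phi> F :: "complex \<Rightarrow> complex"
  assumes hol: "\<Phi> holomorphic_on {z. c < Re z}"
    and pos: "\<And>z. c < Re z \<Longrightarrow> 0 < Re (deriv \<Phi> z)"
    and contF: "continuous_on {z. c < Re z} F"
    and ImF: "\<And>z. c < Re z \<Longrightarrow> Im (F z) = Im (\<Phi> z)"
    and loc: "\<And>z. c < Re z \<Longrightarrow> \<exists>r>0. inj_on F (ball z r \<inter> {z. c < Re z})"
begin

lemma Im_strict_mono_vertical: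
  assumes "c < s" "v < w"
  shows "Im (\<Phi> (Complex s v)) < Im (\<Phi> (Complex s w))"
proof (rule DERIV_pos_imp_increasing[OF assms(2)])
  fix t
  have "(\<Phi> has_field_derivative deriv \<Phi> (Complex s t)) (at (Complex s t))"
    using holomorphic_derivI[OF hol open_halfspace_Re_gt] assms by simp
  from has_field_derivative_Im[OF has_vector_derivative_vertical[OF this]]
  show "\<exists>y. ((\<lambda>v. Im (\<Phi> (Complex s v))) has_real_derivative y) (at t) \<and> 0 < y"
    using pos[of "Complex s t"] assms by auto
qed

lemma Im_inj_vertical:
  assumes "c < s" "Im (\<Phi> (Complex s v)) = Im (\<Phi> (Complex s w))"
  shows "v = w"
  using Im_strict_mono_vertical[OF assms(1), of v w] Im_strict_mono_vertical[OF assms(1), of w v] assms(2)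
  by (cases v w rule: linorder_cases) auto

definition level_dom :: "real \<Rightarrow> real set" where
  "level_dom y = {s. c < s \<and> (\<exists>v. Im (\<Phi> (Complex s v)) = y)}"

text \<open>On \<open>level_dom y\<close> the choice is unique by \<open>Im_inj_vertical\<close>;
  elsewhere the value carries no meaning.\<close>

definition level_height :: "real \<Rightarrow> real \<Rightarrow> real" where
  "level_height y s = (SOME v. Im (\<Phi> (Complex s v)) = y)"

definition level_curve :: "real \<Rightarrow> real \<Rightarrow> complex" where
  "level_curve y s = Complex s (level_height y s)"

lemma Im_level_height:
  "s \<in> level_dom y \<Longrightarrow> Im (\<Phi> (Complex s (level_height y s))) = y"
  unfolding level_dom_def level_height_def by (auto intro: someI)

lemma level_curve_Re:
  assumes "c < Re z"
  shows "Re z \<in> level_dom (Im (\<Phi> z))" "level_curve (Im (\<Phi> z)) (Re z) = z"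
proof -
  show *: "Re z \<in> level_dom (Im (\<Phi> z))"
    using assms unfolding level_dom_def by (auto intro!: exI[of _ "Im z"])
  have "level_height (Im (\<Phi> z)) (Re z) = Im z"
    by (rule Im_inj_vertical[OF assms]) (use Im_level_height[OF *] in simp)
  thus "level_curve (Im (\<Phi> z)) (Re z) = z" by (simp add: level_curve_def complex_eq_iff)
qed

lemma is_interval_level_dom: "is_interval (level_dom y)"
  unfolding is_interval_1
proof (intro ballI allI impI, elim conjE)
  fix a b x assume ab: "a \<in> level_dom y" "b \<in> level_dom y" "a \<le> x" "x \<le> b"
  show "x \<in> level_dom y"
  proof (cases "x = a \<or> x = b")
    case False
    thus ?thesis
      using ab ex_Im_eq_on_vertical_line[OF hol pos, of a x b _ y] unfolding level_dom_def by fastforce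
  qed (use ab in auto)
qed

lemma continuous_on_\<Phi>_horizontal: "continuous_on {c<..} (\<lambda>s. Im (\<Phi> (Complex s v)))"
proof -
  have "continuous_on {c<..} (\<lambda>s. \<Phi> (Complex s v))"
    by (rule continuous_on_compose2[OF holomorphic_on_imp_continuous_on[OF hol]])
       (auto simp: Complex_eq intro!: continuous_intros)
  thus ?thesis by (intro continuous_intros)
qed

text \<open>By vertical monotonicity, comparing the height at \<open>t\<close> with a constant
  \<open>a\<close> amounts to comparing \<open>Im (\<Phi> (Complex t a))\<close> with
  \<open>y\<close>, and the latter is continuous in \<open>t\<close>.\<close>

lemma continuous_on_level_height: "continuous_on (level_dom y) (level_height y)"
  unfolding continuous_on_def
proof (intro ballI order_tendstoI)
  let ?v = "level_height y"
  fix s a assume s: "s \<in> level_dom y"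
  hence cs: "c < s" by (simp add: level_dom_def)
  have lim: "((\<lambda>t. Im (\<Phi> (Complex t a))) \<longlongrightarrow> Im (\<Phi> (Complex s a))) (at s within level_dom y)"
    by (rule tendsto_within_subset[where S = "{c<..}"])
       (use continuous_on_\<Phi>_horizontal[of a] cs in \<open>auto simp: continuous_on_def level_dom_def\<close>)
  have dom: "\<forall>\<^sub>F t in at s within level_dom y. t \<in> level_dom y"
    by (simp add: eventually_at_filter)
  have less_iff: "a < ?v t \<longleftrightarrow> Im (\<Phi> (Complex t a)) < y" "?v t < a \<longleftrightarrow> y < Im (\<Phi> (Complex t a))"
    if t: "t \<in> level_dom y" for t
  proof -
    have "c < t" using t by (simp add: level_dom_def)
    thus "a < ?v t \<longleftrightarrow> Im (\<Phi> (Complex t a)) < y" "?v t < a \<longleftrightarrow> y < Im (\<Phi> (Complex t a))"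
      using Im_level_height[OF t] Im_strict_mono_vertical[of t a "?v t"]
        Im_strict_mono_vertical[of t "?v t" a]
      by (cases a "?v t" rule: linorder_cases; simp)+
  qed
  show "\<forall>\<^sub>F t in at s within level_dom y. a < ?v t" if "a < ?v s"
  proof -
    have "Im (\<Phi> (Complex s a)) < y" using that less_iff[OF s] by simp
    from order_tendstoD(2)[OF lim this] dom show ?thesis
      by eventually_elim (simp add: less_iff)
  qed
  show "\<forall>\<^sub>F t in at s within level_dom y. ?v t < a" if "?v s < a"
  proof -
    have "y < Im (\<Phi> (Complex s a))" using that less_iff[OF s] by simp
    from order_tendstoD(1)[OF lim this] dom show ?thesis
      by eventually_elim (simp add: less_iff)
  qed
qed

lemma continuous_on_level_curve: "continuous_on (level_dom y) (level_curve y)"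
  unfolding level_curve_def Complex_eq
  by (intro continuous_intros continuous_on_level_height)

lemma level_curve_in: "s \<in> level_dom y \<Longrightarrow> c < Re (level_curve y s)"
  by (simp add: level_curve_def level_dom_def)

lemma Im_F_level_curve: "s \<in> level_dom y \<Longrightarrow> Im (F (level_curve y s)) = y"
  using ImF[OF level_curve_in] Im_level_height by (simp add: level_curve_def)

lemma continuous_on_Re_F_level_curve: "continuous_on (level_dom y) (\<lambda>s. Re (F (level_curve y s)))"
  by (intro continuous_intros continuous_on_compose2[OF contF continuous_on_level_curve])
     (auto simp: level_curve_in)

text \<open>\<open>Im F\<close> is constant on a level curve, so equal real parts mean equal values
  of \<open>F\<close>. Local injectivity of \<open>F\<close> thus passes to a continuous real
  function on an interval, where it becomes global.\<close>

lemma inj_on_Re_F_level_curve: "inj_on (\<lambda>s. Re (F (level_curve y s))) (level_dom y)"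
proof (rule inj_on_interval_of_locally_inj[OF is_interval_level_dom continuous_on_Re_F_level_curve])
  fix s assume s: "s \<in> level_dom y"
  obtain r where r: "r > 0" "inj_on F (ball (level_curve y s) r \<inter> {z. c < Re z})"
    using loc[OF level_curve_in[OF s]] by blast
  obtain e where e: "e > 0"
    "\<And>t. t \<in> level_dom y \<Longrightarrow> dist t s < e \<Longrightarrow> dist (level_curve y t) (level_curve y s) < r"
    using continuous_on_level_curve[of y] s r(1) unfolding continuous_on_iff by metis
  have "inj_on (\<lambda>s. Re (F (level_curve y s))) (level_dom y \<inter> ball s e)"
  proof (rule inj_onI)
    fix t t' assume t: "t \<in> level_dom y \<inter> ball s e" "t' \<in> level_dom y \<inter> ball s e"
      "Re (F (level_curve y t)) = Re (F (level_curve y t'))"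
    hence "F (level_curve y t) = F (level_curve y t')"
      by (auto simp: complex_eq_iff Im_F_level_curve)
    hence "level_curve y t = level_curve y t'"
      by (rule inj_onD[OF r(2)]) (use t e(2) level_curve_in in \<open>auto simp: dist_commute[of s] dist_commute[of "level_curve y s"]\<close>)
    thus "t = t'" by (simp add: level_curve_def)
  qed
  thus "\<exists>e>0. inj_on (\<lambda>s. Re (F (level_curve y s))) (level_dom y \<inter> ball s e)" using e(1) by blast
qed

text \<open>Points with equal values of \<open>F\<close> lie on one level curve, where
  \<open>Re F\<close> is injective.\<close>

lemma inj_on_F: "inj_on F {z. c < Re z}"
proof (rule inj_onI)
  fix z w assume "z \<in> {z. c < Re z}" "w \<in> {z. c < Re z}" and eq: "F z = F w"
  hence z: "c < Re z" and w: "c < Re w" by auto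
  have y: "Im (\<Phi> z) = Im (\<Phi> w)" using ImF[OF z] ImF[OF w] eq by simp
  note lc = level_curve_Re[OF z] level_curve_Re[OF w, folded y]
  have "Re z = Re w"
    by (rule inj_onD[OF inj_on_Re_F_level_curve[of "Im (\<Phi> z)"]]) (use lc eq in auto)
  thus "z = w" using lc by metis
qed

text \<open>Both points lie on one level curve, along which \<open>Re F\<close> takes an interval of
  values while \<open>Im F\<close> stays fixed.\<close>

lemma horizontal_segment_subset_image:
  assumes z: "c < Re z" and w: "c < Re w" and eq: "Im (F z) = Im (F w)"
  shows "closed_segment (F z) (F w) \<subseteq> F ` {z. c < Re z}"
proof
  fix q assume q: "q \<in> closed_segment (F z) (F w)"
  define y where "y = Im (\<Phi> z)"
  define m where "m s = Re (F (level_curve y s))" for s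
  have y: "Im (\<Phi> w) = y" "Im (F z) = y" "Im (F w) = y"
    using ImF[OF z] ImF[OF w] eq by (auto simp: y_def)
  note lz = level_curve_Re[OF z, folded y_def] and lw = level_curve_Re[OF w, unfolded y]
  have "connected (m ` level_dom y)"
    unfolding m_def by (intro connected_continuous_image continuous_on_Re_F_level_curve)
      (simp add: is_interval_connected_1[symmetric] is_interval_level_dom)
  hence "convex (m ` level_dom y)"
    by (simp add: is_interval_connected_1[symmetric] is_interval_convex_1)
  moreover have "m (Re z) = Re (F z)" "m (Re w) = Re (F w)" using lz lw by (auto simp: m_def)
  hence "Re (F z) \<in> m ` level_dom y" "Re (F w) \<in> m ` level_dom y" using lz lw by (metis imageI)+
  ultimately have "closed_segment (Re (F z)) (Re (F w)) \<subseteq> m ` level_dom y"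
    by (simp add: closed_segment_subset)
  moreover have "Re q \<in> closed_segment (Re (F z)) (Re (F w))"
    using q by (auto simp: in_segment)
  ultimately obtain s where s: "s \<in> level_dom y" "Re q = m s" by blast
  have "Im q = y"
  proof -
    obtain u where "q = (1 - u) *\<^sub>R F z + u *\<^sub>R F w" using q by (auto simp: in_segment)
    hence "Im q = (1 - u) * Im (F z) + u * Im (F w)" by simp
    thus ?thesis using y by (simp add: algebra_simps)
  qed
  hence "q = F (level_curve y s)" using s by (simp add: complex_eq_iff m_def Im_F_level_curve)
  thus "q \<in> F ` {z. c < Re z}" using level_curve_in[OF s(1)] by blast
qed

end

section \<open>Taylor coefficients and Hadamard products\<close>

lemma taylor_coeff_sums:
  assumes "f holomorphic_on unit_disk" "norm z < 1"
  shows "(\<lambda>n. taylor_coeff f n * z ^ n) sums f z"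
  using holomorphic_power_series[OF assms(1), of z] assms(2) by (simp add: taylor_coeff_def)

lemma taylor_coeff_eqI:
  assumes "\<And>z. norm z < 1 \<Longrightarrow> (\<lambda>n. a n * z ^ n) sums f z"
  shows "taylor_coeff f n = a n"
proof -
  have "\<forall>\<^sub>F z in nhds 0. z \<in> unit_disk"
    by (rule eventually_nhds_in_open) auto
  hence "\<forall>\<^sub>F z in nhds 0. (\<lambda>n. fps_nth (Abs_fps a) n * z ^ n) sums f z"
    by eventually_elim (use assms in simp)
  hence "f has_fps_expansion Abs_fps a" by (rule has_fps_expansionI)
  from fps_nth_fps_expansion[OF this, of n] show ?thesis by (simp add: taylor_coeff_def)
qed

lemma summable_norm_taylor:
  assumes "f holomorphic_on unit_disk" "norm z < 1"
  shows "summable (\<lambda>n. norm (taylor_coeff f n * z ^ n))"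
proof (rule powser_insidea)
  define r where "r = (1 + norm z) / 2"
  have r: "norm z < r" "r < 1" "0 < r"
    using assms(2) by (simp_all add: r_def add_pos_nonneg)
  thus "norm z < norm (of_real r :: complex)" by simp
  show "summable (\<lambda>n. taylor_coeff f n * of_real r ^ n)"
    using taylor_coeff_sums[OF assms(1), of "of_real r"] r by (simp add: sums_iff)
qed

text \<open>With \<open>norm r ^ 2 = norm z\<close>, each function receives one factor
  \<open>r ^ n\<close>: the terms of one series are eventually below 1, those of the other
  absolutely summable.\<close>

lemma summable_hadamard:
  assumes f: "f holomorphic_on unit_disk" and g: "g holomorphic_on unit_disk" and z: "norm z < 1"
  shows "summable (\<lambda>n. taylor_coeff f n * taylor_coeff g n * z ^ n)"
proof -
  define r where "r = complex_of_real (sqrt (norm z))"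
  have r: "norm r < 1" "norm r ^ 2 = norm z" using z by (auto simp: r_def)
  have "(\<lambda>n. norm (taylor_coeff f n * r ^ n)) \<longlonglongrightarrow> 0"
    by (rule summable_LIMSEQ_zero[OF summable_norm_taylor[OF f r(1)]])
  hence "\<forall>\<^sub>F n in sequentially. norm (taylor_coeff f n * r ^ n) < 1"
    by (rule order_tendstoD) simp
  hence "\<forall>\<^sub>F n in sequentially. norm (taylor_coeff f n * taylor_coeff g n * z ^ n)
      \<le> norm (taylor_coeff g n * r ^ n)"
  proof eventually_elim
    case (elim n)
    have "norm (z ^ n) = norm (r ^ n) * norm (r ^ n)"
      by (simp add: norm_power r(2)[symmetric] power2_eq_square power_mult_distrib)
    hence "norm (taylor_coeff f n * taylor_coeff g n * z ^ n)
        = norm (taylor_coeff f n * r ^ n) * norm (taylor_coeff g n * r ^ n)"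
      by (simp add: norm_mult)
    also have "\<dots> \<le> 1 * norm (taylor_coeff g n * r ^ n)"
      using elim by (intro mult_right_mono) auto
    finally show ?case by simp
  qed
  from summable_comparison_test_ev[OF this summable_norm_taylor[OF g r(1)]] show ?thesis .
qed

lemma continuous_on_hadamard:
  assumes f: "f holomorphic_on unit_disk" and g: "g holomorphic_on unit_disk"
  shows "continuous_on unit_disk (hadamard f g)"
proof (rule continuous_at_imp_continuous_on, rule ballI)
  fix z assume z: "z \<in> unit_disk"
  define r where "r = (1 + norm z) / 2"
  have "norm z < 1" using z by simp
  hence r: "norm z < r" "r < 1" "0 < r"
    by (simp_all add: r_def add_pos_nonneg)
  have "isCont (\<lambda>z. \<Sum>n. taylor_coeff f n * taylor_coeff g n * z ^ n) z"
    by (rule isCont_powser[of _ "of_real r"]) (use summable_hadamard[OF f g] r in auto)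
  thus "isCont (hadamard f g) z" by (simp add: hadamard_def[abs_def])
qed

text \<open>Uniqueness of Taylor coefficients, with the right-hand side expanded as a geometric
  series shifted by the factor \<open>z\<close>.\<close>

lemma taylor_coeff_half_plane_map:
  assumes h: "h holomorphic_on unit_disk" and g: "g holomorphic_on unit_disk" and e: "norm e = 1"
    and eq: "\<And>z. norm z < 1 \<Longrightarrow> h z + q * g z = c * z / (1 - e * z)"
  shows "taylor_coeff h n + q * taylor_coeff g n = (if n = 0 then 0 else c * e ^ (n - 1))"
proof -
  let ?s = "\<lambda>z. h z + q * g z"
  have "(\<lambda>n. (taylor_coeff h n + q * taylor_coeff g n) * z ^ n) sums ?s z" if "norm z < 1" for z
    using sums_add[OF taylor_coeff_sums[OF h that] sums_mult[OF taylor_coeff_sums[OF g that], of q]]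
    by (simp add: algebra_simps)
  from taylor_coeff_eqI[of _ ?s, OF this]
  have 1: "taylor_coeff ?s n = taylor_coeff h n + q * taylor_coeff g n" .
  have "(\<lambda>n. (if n = 0 then 0 else c * e ^ (n - 1)) * z ^ n) sums ?s z" if z: "norm z < 1" for z
  proof -
    have "norm (e * z) < 1" using z e by (simp add: norm_mult)
    hence "(\<lambda>n. c * z * (e * z) ^ n) sums (c * z * (1 / (1 - e * z)))"
      by (intro sums_mult geometric_sums)
    hence "(\<lambda>n. (if Suc n = 0 then 0 else c * e ^ (Suc n - 1)) * z ^ Suc n) sums ?s z"
      using eq[OF z] by (simp add: power_mult_distrib mult_ac)
    thus ?thesis by (subst (asm) sums_Suc_iff) simp
  qed
  from taylor_coeff_eqI[of _ ?s, OF this] 1 show ?thesis by simp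
qed

text \<open>Polarization: with \<open>s = h + q g\<close> and \<open>k = h - q g\<close>, the convolution combination
  \<open>h1 * h2 - q1 q2 g1 * g2\<close> equals \<open>(s1 * k2 + k1 * s2) / 2\<close>, and convolving with the
  half-plane map \<open>s\<close> only rescales the argument.\<close>
lemma hadamard_shear:
  assumes h1: "h1 holomorphic_on unit_disk" and g1: "g1 holomorphic_on unit_disk" and e1: "norm e1 = 1"
    and h2: "h2 holomorphic_on unit_disk" and g2: "g2 holomorphic_on unit_disk" and e2: "norm e2 = 1"
    and eq1: "\<And>z. norm z < 1 \<Longrightarrow> h1 z + q1 * g1 z = c1 * z / (1 - e1 * z)"
    and eq2: "\<And>z. norm z < 1 \<Longrightarrow> h2 z + q2 * g2 z = c2 * z / (1 - e2 * z)"
    and 0: "h1 0 = 0" "g1 0 = 0" "h2 0 = 0" "g2 0 = 0"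
    and z: "norm z < 1"
  shows "hadamard h1 h2 z - q1 * q2 * hadamard g1 g2 z =
    (c1 / e1 * (h2 (e1 * z) - q2 * g2 (e1 * z)) + c2 / e2 * (h1 (e2 * z) - q1 * g1 (e2 * z))) / 2"
    (is "_ = ?R")
proof -
  let ?a1 = "taylor_coeff h1" and ?b1 = "taylor_coeff g1"
  let ?a2 = "taylor_coeff h2" and ?b2 = "taylor_coeff g2"
  have L: "(\<lambda>n. ?a1 n * ?a2 n * z ^ n - q1 * q2 * (?b1 n * ?b2 n * z ^ n)) sums
      (hadamard h1 h2 z - q1 * q2 * hadamard g1 g2 z)"
    unfolding hadamard_def
    by (intro sums_diff sums_mult summable_sums summable_hadamard assms)
  have n1: "norm (e1 * z) < 1" and n2: "norm (e2 * z) < 1" using z e1 e2 by (auto simp: norm_mult)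
  have nz: "e1 \<noteq> 0" "e2 \<noteq> 0" using e1 e2 by auto
  have "(\<lambda>n. (c1 / e1 * (?a2 n * (e1 * z) ^ n - q2 * (?b2 n * (e1 * z) ^ n))
      + c2 / e2 * (?a1 n * (e2 * z) ^ n - q1 * (?b1 n * (e2 * z) ^ n))) / 2) sums ?R"
    by (intro sums_add sums_diff sums_mult sums_divide taylor_coeff_sums assms n1 n2)
  moreover have "(c1 / e1 * (?a2 n * (e1 * z) ^ n - q2 * (?b2 n * (e1 * z) ^ n))
      + c2 / e2 * (?a1 n * (e2 * z) ^ n - q1 * (?b1 n * (e2 * z) ^ n))) / 2
      = ?a1 n * ?a2 n * z ^ n - q1 * q2 * (?b1 n * ?b2 n * z ^ n)" for n
  \<comment> \<open>The half-plane map has no constant term, so index 0 is separate; there all four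
    coefficients vanish.\<close>
  proof (cases n)
    case 0
    thus ?thesis using assms(9-12) by (simp add: taylor_coeff_def)
  next
    case (Suc m)
    have s1: "c1 * e1 ^ m = ?a1 n + q1 * ?b1 n"
      using taylor_coeff_half_plane_map[OF h1 g1 e1 eq1, of n] Suc by simp
    have s2: "c2 * e2 ^ m = ?a2 n + q2 * ?b2 n"
      using taylor_coeff_half_plane_map[OF h2 g2 e2 eq2, of n] Suc by simp
    \<comment> \<open>Dividing \<open>(e1 * z) ^ n\<close> by \<open>e1\<close> leaves
      \<open>e1 ^ m\<close>, so the prefactor is the coefficient of \<open>h1 + q1 g1\<close>. In
      the sum of \<open>X\<close> and \<open>Y\<close> the mixed products cancel.\<close>
    have X: "c1 / e1 * (?a2 n * (e1 * z) ^ n - q2 * (?b2 n * (e1 * z) ^ n))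
        = (c1 * e1 ^ m) * (?a2 n - q2 * ?b2 n) * z ^ n"
      using nz Suc by (simp add: field_simps power_mult_distrib)
    have Y: "c2 / e2 * (?a1 n * (e2 * z) ^ n - q1 * (?b1 n * (e2 * z) ^ n))
        = (c2 * e2 ^ m) * (?a1 n - q1 * ?b1 n) * z ^ n"
      using nz Suc by (simp add: field_simps power_mult_distrib)
    show ?thesis unfolding X Y s1 s2 by (simp add: field_simps)
  qed
  ultimately have "(\<lambda>n. ?a1 n * ?a2 n * z ^ n - q1 * q2 * (?b1 n * ?b2 n * z ^ n)) sums ?R"
    by (simp only:)
  with L show ?thesis by (rule sums_unique2)
qed

section \<open>Half-plane coordinates and the derivative of the shear\<close>

text \<open>The real part of \<open>(a - b) * cnj (a + b)\<close> is the difference of the squared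
  norms.\<close>

lemma Re_diff_divide_sum_pos:
  fixes a b :: complex
  assumes "norm b < norm a"
  shows "0 < Re ((a - b) / (a + b))"
proof -
  have nz: "a + b \<noteq> 0" using assms by (metis add_eq_0_iff less_irrefl norm_minus_cancel)
  have "(norm b)\<^sup>2 < (norm a)\<^sup>2" using assms by (simp add: power_strict_mono)
  hence "0 < Re ((a - b) * cnj (a + b))"
    unfolding cmod_power2 by (simp add: power2_eq_square algebra_simps)
  thus ?thesis using nz by (simp add: Re_complex_div_gt_0 del: complex_cnj_add)
qed

text \<open>To the right of \<open>Re \<zeta> = -1/2\<close> a point is closer to 0 than to
  -1.\<close>

lemma norm_divide_one_plus_less_1:
  assumes "- 1 / 2 < Re \<zeta>"
  shows "1 + \<zeta> \<noteq> 0" "norm (\<zeta> / (1 + \<zeta>)) < 1"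
proof -
  have "Re (1 + \<zeta>) \<noteq> 0" using assms by simp
  thus nz: "1 + \<zeta> \<noteq> 0" by (metis zero_complex.simps(1))
  have "(norm \<zeta>)\<^sup>2 < (norm (1 + \<zeta>))\<^sup>2"
    using assms unfolding cmod_power2 by (simp add: power2_eq_square algebra_simps)
  hence "norm \<zeta> < norm (1 + \<zeta>)" by (rule power_less_imp_less_base) simp
  thus "norm (\<zeta> / (1 + \<zeta>)) < 1" using nz by (simp add: norm_divide)
qed

lemma Re_divide_one_minus_gt:
  assumes "norm z < 1"
  shows "1 - z \<noteq> 0" "- 1 / 2 < Re (z / (1 - z))"
proof -
  show nz: "1 - z \<noteq> 0" using assms by auto
  define x where "x = (1 + z) / (1 - z)"
  have "0 < Re ((1 - (- z)) / (1 + (- z)))" using assms by (intro Re_diff_divide_sum_pos) simp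
  hence "0 < Re x" by (simp add: x_def)
  moreover have "z / (1 - z) = x / 2 - 1 / 2" using nz by (simp add: x_def field_simps)
  ultimately show "- 1 / 2 < Re (z / (1 - z))" by simp
qed

text \<open>Differentiating the shear equation gives \<open>h' + q g' = c (1 + \<zeta>)^2\<close> at
  the transformed point, which cancels against the chain rule factor
  \<open>1 / (1 + \<zeta>)^2\<close>. What remains is \<open>c (h' - q g') / (h' + q g')\<close>, of
  positive real part because \<open>|g'| < |h'|\<close>.\<close>

lemma Re_deriv_shear_pos:
  assumes h: "h holomorphic_on unit_disk" and g: "g holomorphic_on unit_disk" and e: "norm e = 1"
    and q: "norm q = 1" and c: "0 < (c :: real)"
    and eq: "\<And>z. norm z < 1 \<Longrightarrow> h z + q * g z = c * z / (1 - e * z)"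
    and less: "\<And>z. norm z < 1 \<Longrightarrow> norm (deriv g z) < norm (deriv h z)"
    and \<zeta>: "- 1 / 2 < Re \<zeta>"
  shows "\<exists>D. ((\<lambda>\<zeta>. e * (h (\<zeta> / (1 + \<zeta>) / e) - q * g (\<zeta> / (1 + \<zeta>) / e))) has_field_derivative D) (at \<zeta>)
    \<and> 0 < Re D"
proof -
  define w where "w = \<zeta> / (1 + \<zeta>) / e"
  have nz: "1 + \<zeta> \<noteq> 0" "e \<noteq> 0" using norm_divide_one_plus_less_1(1)[OF \<zeta>] e by auto
  have w: "norm w < 1" using norm_divide_one_plus_less_1(2)[OF \<zeta>] e by (simp add: w_def norm_divide norm_mult)
  have dh: "(h has_field_derivative deriv h w) (at w)"
    and dg: "(g has_field_derivative deriv g w) (at w)"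
    using w by (auto intro!: holomorphic_derivI[OF h] holomorphic_derivI[OF g])
  have "e * w = \<zeta> / (1 + \<zeta>)" using nz by (simp add: w_def)
  hence ew: "1 - e * w = 1 / (1 + \<zeta>)" using nz by (simp add: field_simps)
  have nz': "1 - e * w \<noteq> 0" using ew nz by simp
  have "((\<lambda>z. h z + q * g z) has_field_derivative deriv h w + q * deriv g w) (at w)"
    by (intro DERIV_add DERIV_cmult dh dg)
  moreover have "((\<lambda>z. c * z / (1 - e * z)) has_field_derivative c / (1 - e * w)\<^sup>2) (at w)"
    by (rule derivative_eq_intros refl nz')+ (use nz' in \<open>simp add: field_simps power2_eq_square\<close>)
  hence "((\<lambda>z. h z + q * g z) has_field_derivative c / (1 - e * w)\<^sup>2) (at w)"
    by (rule has_field_derivative_transform_within_open[where S = unit_disk]) (use w eq in auto)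
  ultimately have sum: "deriv h w + q * deriv g w = c * (1 + \<zeta>)\<^sup>2"
    using DERIV_unique ew by (fastforce simp: power_divide)
  have dT: "((\<lambda>\<zeta>. \<zeta> / (1 + \<zeta>) / e) has_field_derivative 1 / (1 + \<zeta>)\<^sup>2 / e) (at \<zeta>)"
  proof (rule DERIV_cdivide)
    show "((\<lambda>\<zeta>. \<zeta> / (1 + \<zeta>)) has_field_derivative 1 / (1 + \<zeta>)\<^sup>2) (at \<zeta>)"
      by (rule derivative_eq_intros refl nz)+ (use nz in \<open>simp add: power2_eq_square\<close>)
  qed
  let ?D = "(deriv h w - q * deriv g w) / (1 + \<zeta>)\<^sup>2"
  have "((\<lambda>\<zeta>. e * (h (\<zeta> / (1 + \<zeta>) / e) - q * g (\<zeta> / (1 + \<zeta>) / e))) has_field_derivative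
      e * (deriv h w * (1 / (1 + \<zeta>)\<^sup>2 / e) - q * (deriv g w * (1 / (1 + \<zeta>)\<^sup>2 / e)))) (at \<zeta>)"
    by (intro DERIV_cmult DERIV_diff DERIV_chain2[OF _ dT]) (use dh dg in \<open>auto simp: w_def\<close>)
  moreover have "e * (deriv h w * (1 / (1 + \<zeta>)\<^sup>2 / e) - q * (deriv g w * (1 / (1 + \<zeta>)\<^sup>2 / e))) = ?D"
    using nz by (simp add: field_simps)
  moreover define Q where "Q = (deriv h w - q * deriv g w) / (deriv h w + q * deriv g w)"
  have "?D = c * Q"
    unfolding Q_def sum using nz c by (simp add: field_simps)
  moreover have "0 < Re Q"
    unfolding Q_def using less[OF w] q by (intro Re_diff_divide_sum_pos) (simp add: norm_mult)
  hence "0 < Re (c * Q)" using c by simp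
  ultimately show ?thesis by metis
qed

text \<open>Conjugating \<open>E * cnj (G z)\<close> flips the sign of its imaginary part, and
  \<open>cnj E = E * inverse (E^2)\<close> on the unit circle.\<close>

lemma Im_mult_harm:
  assumes "norm E = 1"
  shows "Im (E * harm H G z) = Im (E * (H z - inverse (E\<^sup>2) * G z))"
proof -
  have "E \<noteq> 0" using assms by auto
  have "cnj E = inverse E" using assms by (metis complex_div_cnj inverse_eq_divide mult_1 div_by_1 of_real_1 power_one)
  hence "E * inverse (E\<^sup>2) = cnj E" using \<open>E \<noteq> 0\<close> by (simp add: power2_eq_square)
  hence "E * (H z - inverse (E\<^sup>2) * G z) = E * H z - cnj E * G z"
    by (simp only: right_diff_distrib mult.assoc[symmetric])
  moreover have "Im (E * harm H G z) = Im (E * H z - cnj E * G z)"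
    by (simp add: harm_def algebra_simps)
  ultimately show ?thesis by simp
qed

section \<open>The convolution in half-plane coordinates\<close>

text \<open>Angle-free form of the theorem: rotations enter as unimodular \<open>e1\<close>,
  \<open>e2\<close>, and directional convexity as segments between image points on a common level
  line of \<open>Im (e1 * e2 * p)\<close>.\<close>

lemma harm_conv_inj_and_segments:
  assumes f1: "in_S_H h1 g1" and f2: "in_S_H h2 g2"
    and e1: "norm e1 = 1" and e2: "norm e2 = 1" and c1: "0 < (c1 :: real)" and c2: "0 < (c2 :: real)"
    and eq1: "\<And>z. norm z < 1 \<Longrightarrow> h1 z + inverse (e1\<^sup>2) * g1 z = c1 * z / (1 - e1 * z)"
    and eq2: "\<And>z. norm z < 1 \<Longrightarrow> h2 z + inverse (e2\<^sup>2) * g2 z = c2 * z / (1 - e2 * z)"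
    and lu: "locally_univalent (harm_conv h1 g1 h2 g2) unit_disk"
  shows "inj_on (harm_conv h1 g1 h2 g2) unit_disk" (is ?inj)
    and "\<lbrakk>z \<in> unit_disk; w \<in> unit_disk;
          Im (e1 * e2 * harm_conv h1 g1 h2 g2 z) = Im (e1 * e2 * harm_conv h1 g1 h2 g2 w)\<rbrakk>
      \<Longrightarrow> closed_segment (harm_conv h1 g1 h2 g2 z) (harm_conv h1 g1 h2 g2 w)
        \<subseteq> harm_conv h1 g1 h2 g2 ` unit_disk" (is "\<lbrakk>_; _; _\<rbrakk> \<Longrightarrow> ?seg")
proof -
  define f where "f = harm_conv h1 g1 h2 g2"
  define E where "E = e1 * e2"
  define S where "S \<zeta> = \<zeta> / (1 + \<zeta>) / E" for \<zeta>
  define F where "F \<zeta> = E * f (S \<zeta>)" for \<zeta>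
  define \<phi>1 where "\<phi>1 \<zeta> = e1 * (h1 (\<zeta> / (1 + \<zeta>) / e1) - inverse (e1\<^sup>2) * g1 (\<zeta> / (1 + \<zeta>) / e1))" for \<zeta>
  define \<phi>2 where "\<phi>2 \<zeta> = e2 * (h2 (\<zeta> / (1 + \<zeta>) / e2) - inverse (e2\<^sup>2) * g2 (\<zeta> / (1 + \<zeta>) / e2))" for \<zeta>
  \<comment> \<open>The indices cross because convolving with the half-plane map of one factor
    rescales the shear of the other.\<close>
  define \<Phi> where "\<Phi> \<zeta> = (c1 * \<phi>2 \<zeta> + c2 * \<phi>1 \<zeta>) / 2" for \<zeta>
  define H where "H = {\<zeta>. - 1 / 2 < Re \<zeta>}"
  have hol: "h1 holomorphic_on unit_disk" "g1 holomorphic_on unit_disk"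
    "h2 holomorphic_on unit_disk" "g2 holomorphic_on unit_disk"
    and zero: "h1 0 = 0" "g1 0 = 0" "h2 0 = 0" "g2 0 = 0"
    and less1: "\<And>z. norm z < 1 \<Longrightarrow> norm (deriv g1 z) < norm (deriv h1 z)"
    and less2: "\<And>z. norm z < 1 \<Longrightarrow> norm (deriv g2 z) < norm (deriv h2 z)"
    using f1 f2 by (auto simp: in_S_H_def)
  have E: "norm E = 1" "E \<noteq> 0" "e1 \<noteq> 0" "e2 \<noteq> 0" using e1 e2 by (auto simp: E_def norm_mult)
  have opH: "open H" unfolding H_def by (rule open_halfspace_Re_gt)
  have S_disk: "norm (S \<zeta>) < 1" if "\<zeta> \<in> H" for \<zeta>
    using norm_divide_one_plus_less_1(2)[of \<zeta>] that E(1) by (simp add: S_def H_def norm_divide norm_mult)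
  have nzH: "1 + \<zeta> \<noteq> 0" if "\<zeta> \<in> H" for \<zeta>
    using norm_divide_one_plus_less_1(1)[of \<zeta>] that by (simp add: H_def)
  define T where "T w = E * w / (1 - E * w)" for w
  have T: "T w \<in> H" "S (T w) = w" if "norm w < 1" for w
  proof -
    have n: "norm (E * w) < 1" using that E(1) by (simp add: norm_mult)
    note Re_divide_one_minus_gt[OF n]
    thus "T w \<in> H" by (simp add: T_def H_def)
    have nz: "1 - E * w \<noteq> 0" using Re_divide_one_minus_gt[OF n] by simp
    hence "1 + T w = 1 / (1 - E * w)" by (simp add: T_def field_simps)
    thus "S (T w) = w" using nz E by (simp add: S_def T_def)
  qed
  have inj_S: "inj_on S H"
  proof (rule inj_onI)
    fix a b assume "a \<in> H" "b \<in> H" "S a = S b"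
    moreover have "E * S x = x / (1 + x)" for x using E by (simp add: S_def)
    ultimately have "a / (1 + a) = b / (1 + b)" "1 + a \<noteq> 0" "1 + b \<noteq> 0" using nzH by metis+
    thus "a = b" by (simp add: field_simps)
  qed
  have contS: "continuous_on H S"
    unfolding S_def using nzH E by (intro continuous_intros) auto
  have contf: "continuous_on unit_disk f"
    unfolding f_def harm_conv_def harm_def
    by (intro continuous_intros continuous_on_hadamard hol)
  have d\<Phi>: "\<exists>D. (\<Phi> has_field_derivative D) (at \<zeta>) \<and> 0 < Re D" if "\<zeta> \<in> H" for \<zeta>
  proof -
    have \<zeta>: "- 1 / 2 < Re \<zeta>" using that by (simp add: H_def)
    obtain D1 where D1: "(\<phi>1 has_field_derivative D1) (at \<zeta>)" "0 < Re D1"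
      using Re_deriv_shear_pos[OF hol(1,2) e1 _ c1 eq1 less1 \<zeta>] e1
      unfolding \<phi>1_def[abs_def] by (auto simp: norm_inverse norm_power)
    obtain D2 where D2: "(\<phi>2 has_field_derivative D2) (at \<zeta>)" "0 < Re D2"
      using Re_deriv_shear_pos[OF hol(3,4) e2 _ c2 eq2 less2 \<zeta>] e2
      unfolding \<phi>2_def[abs_def] by (auto simp: norm_inverse norm_power)
    have "(\<Phi> has_field_derivative (c1 * D2 + c2 * D1) / 2) (at \<zeta>)"
      unfolding \<Phi>_def[abs_def] by (intro DERIV_cdivide DERIV_add DERIV_cmult D1 D2)
    moreover have "0 < Re ((c1 * D2 + c2 * D1) / 2)"
      using c1 c2 D1 D2 by (simp add: add_pos_pos)
    ultimately show ?thesis by blast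
  qed
  have Im_F: "Im (F \<zeta>) = Im (\<Phi> \<zeta>)" if "\<zeta> \<in> H" for \<zeta>
  proof -
    have q: "inverse (E\<^sup>2) = inverse (e1\<^sup>2) * inverse (e2\<^sup>2)" by (simp add: E_def power_mult_distrib)
    have "Im (F \<zeta>) = Im (E * (hadamard h1 h2 (S \<zeta>) - inverse (e1\<^sup>2) * inverse (e2\<^sup>2) * hadamard g1 g2 (S \<zeta>)))"
      unfolding F_def f_def harm_conv_def Im_mult_harm[OF E(1)] q ..
    also have "E * (hadamard h1 h2 (S \<zeta>) - inverse (e1\<^sup>2) * inverse (e2\<^sup>2) * hadamard g1 g2 (S \<zeta>)) = \<Phi> \<zeta>"
    proof -
      \<comment> \<open>As \<open>E = e1 * e2\<close>, multiplying by one rotation leaves division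
        by the other, which matches the arguments in \<open>\<phi>2\<close> and
        \<open>\<phi>1\<close>.\<close>
      have S1: "e1 * S \<zeta> = \<zeta> / (1 + \<zeta>) / e2" "e2 * S \<zeta> = \<zeta> / (1 + \<zeta>) / e1"
        using E by (auto simp: S_def E_def)
      have "hadamard h1 h2 (S \<zeta>) - inverse (e1\<^sup>2) * inverse (e2\<^sup>2) * hadamard g1 g2 (S \<zeta>) =
          (of_real c1 / e1 * (h2 (e1 * S \<zeta>) - inverse (e2\<^sup>2) * g2 (e1 * S \<zeta>))
           + of_real c2 / e2 * (h1 (e2 * S \<zeta>) - inverse (e1\<^sup>2) * g1 (e2 * S \<zeta>))) / 2"
        by (rule hadamard_shear[OF hol(1,2) e1 hol(3,4) e2 _ _ zero S_disk[OF that]])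
           (use eq1 eq2 in auto)
      moreover have "E * ((of_real c1 / e1 * A + of_real c2 / e2 * B) / 2)
          = (of_real c1 * (e2 * A) + of_real c2 * (e1 * B)) / 2" for A B
        using E by (simp add: E_def field_simps)
      ultimately show ?thesis unfolding S1 \<Phi>_def \<phi>1_def \<phi>2_def by (simp only:)
    qed
    finally show ?thesis .
  qed
  interpret vertically_monotone_shear "- 1 / 2" \<Phi> F
  proof
    show "\<Phi> holomorphic_on {z. - 1 / 2 < Re z}"
      using d\<Phi> opH unfolding H_def by (auto simp: holomorphic_on_open)
    show "0 < Re (deriv \<Phi> z)" if "- 1 / 2 < Re z" for z
      using d\<Phi>[of z] that by (auto simp: H_def dest: DERIV_imp_deriv)
    show "continuous_on {z. - 1 / 2 < Re z} F"
      unfolding F_def H_def[symmetric]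
      by (intro continuous_intros continuous_on_compose2[OF contf contS]) (use S_disk in auto)
    show "Im (F z) = Im (\<Phi> z)" if "- 1 / 2 < Re z" for z
      using Im_F that by (simp add: H_def)
    show "\<exists>r>0. inj_on F (ball z r \<inter> {z. - 1 / 2 < Re z})" if "- 1 / 2 < Re z" for z
    proof -
      have z: "z \<in> H" using that by (simp add: H_def)
      \<comment> \<open>Local univalence of \<open>f\<close> is pulled back to \<open>F\<close>
        through \<open>S\<close>, continuous and injective on \<open>H\<close>.\<close>
      obtain r where r: "r > 0" "inj_on f (ball (S z) r \<inter> unit_disk)"
        using lu S_disk[OF z] unfolding locally_univalent_def f_def by (meson mem_ball_0)
      obtain e where e: "e > 0" "\<And>x. x \<in> H \<Longrightarrow> dist x z < e \<Longrightarrow> dist (S x) (S z) < r"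
        using contS z r(1) unfolding continuous_on_iff by metis
      have "inj_on F (ball z e \<inter> H)"
      proof (rule inj_onI)
        fix x y assume xy: "x \<in> ball z e \<inter> H" "y \<in> ball z e \<inter> H" "F x = F y"
        hence "f (S x) = f (S y)" using E by (simp add: F_def)
        hence "S x = S y"
          by (rule inj_onD[OF r(2)])
             (use xy e(2) S_disk in \<open>auto simp: dist_commute[of z] dist_commute[of "S z"]\<close>)
        thus "x = y" using xy inj_onD[OF inj_S] by blast
      qed
      thus ?thesis using e(1) unfolding H_def by blast
    qed
  qed
  have FT: "F (T w) = E * f w" if "norm w < 1" for w using T[OF that] by (simp add: F_def)
  have inj: "inj_on f unit_disk"
  proof (rule inj_onI)
    fix z w assume zw: "z \<in> unit_disk" "w \<in> unit_disk" "f z = f w"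
    hence "F (T z) = F (T w)" by (simp add: FT)
    hence "T z = T w" by (rule inj_onD[OF inj_on_F]) (use T zw in \<open>auto simp: H_def\<close>)
    thus "z = w" using T zw by (metis mem_ball_0)
  qed
  thus ?inj by (simp add: f_def)
  show ?seg if zw: "z \<in> unit_disk" "w \<in> unit_disk"
    and Im_eq: "Im (e1 * e2 * harm_conv h1 g1 h2 g2 z) = Im (e1 * e2 * harm_conv h1 g1 h2 g2 w)"
  proof
    fix p assume p: "p \<in> closed_segment (harm_conv h1 g1 h2 g2 z) (harm_conv h1 g1 h2 g2 w)"
    have "E * p \<in> closed_segment (E * f z) (E * f w)"
    proof -
      obtain u where u: "0 \<le> u" "u \<le> 1" "p = (1 - u) *\<^sub>R f z + u *\<^sub>R f w"
        using p unfolding f_def in_segment by blast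
      hence "E * p = (1 - u) *\<^sub>R (E * f z) + u *\<^sub>R (E * f w)" by (simp add: distrib_left)
      thus ?thesis using u in_segment by blast
    qed
    moreover have "closed_segment (E * f z) (E * f w) \<subseteq> F ` H"
      using horizontal_segment_subset_image[of "T z" "T w"] T zw Im_eq
      by (simp add: FT H_def E_def f_def)
    ultimately obtain \<zeta> where "\<zeta> \<in> H" "E * p = F \<zeta>" by blast
    hence "p = f (S \<zeta>)" "S \<zeta> \<in> unit_disk" using E S_disk by (auto simp: F_def)
    thus "p \<in> harm_conv h1 g1 h2 g2 ` unit_disk" by (simp add: f_def)
  qed
qed

section \<open>From angles and lines to unimodular factors and segments\<close>

theorem theorem2:
  fixes a1 a2 :: complex and \<gamma>1 \<gamma>2 :: real
    and h1 g1 h2 g2 :: "complex \<Rightarrow> complex"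
  assumes a1: "a1 \<in> unit_disk" and a2: "a2 \<in> unit_disk"
    and g1r: "0 \<le> \<gamma>1" "\<gamma>1 < 2 * pi"
    and g2r: "0 \<le> \<gamma>2" "\<gamma>2 < 2 * pi"
    and f1: "in_S_half_plane a1 \<gamma>1 h1 g1"
    and f2: "in_S_half_plane a2 \<gamma>2 h2 g2"
    and e1: "\<forall>z\<in>unit_disk.
       h1 z + exp (- 2 * \<i> * of_real (\<gamma>1 + Arg (1 + cnj a1))) * g1 z
         = of_real (1 + (cmod (1 + a1) - 1)) * z / (1 - exp (\<i> * of_real (\<gamma>1 + Arg (1 + cnj a1))) * z)"
    and e2: "\<forall>z\<in>unit_disk.
       h2 z + exp (- 2 * \<i> * of_real (\<gamma>2 + Arg (1 + cnj a2))) * g2 z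
         = of_real (1 + (cmod (1 + a2) - 1)) * z / (1 - exp (\<i> * of_real (\<gamma>2 + Arg (1 + cnj a2))) * z)"
    and lu: "locally_univalent (harm_conv h1 g1 h2 g2) unit_disk"
  shows "inj_on (harm_conv h1 g1 h2 g2) unit_disk \<and>
         convex_in_direction (- (\<gamma>1 + \<gamma>2 + Arg (1 + cnj a1) + Arg (1 + cnj a2)))
           (harm_conv h1 g1 h2 g2 ` unit_disk)"
  proof -
  define b1 where "b1 = \<gamma>1 + Arg (1 + cnj a1)"
  define b2 where "b2 = \<gamma>2 + Arg (1 + cnj a2)"
  define u1 where "u1 = exp (\<i> * of_real b1)"
  define u2 where "u2 = exp (\<i> * of_real b2)"
  let ?f = "harm_conv h1 g1 h2 g2"
  have inv: "exp (- 2 * \<i> * of_real b1) = inverse (u1\<^sup>2)" "exp (- 2 * \<i> * of_real b2) = inverse (u2\<^sup>2)"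
    by (simp_all add: u1_def u2_def exp_minus[symmetric] exp_double[symmetric] mult.assoc flip: power_inverse)
  have c: "0 < cmod (1 + a1)" "0 < cmod (1 + a2)"
    using a1 a2 by (auto simp: add_eq_0_iff dest: arg_cong[where f = norm])
  have u: "norm u1 = 1" "norm u2 = 1" by (simp_all add: u1_def u2_def)
  have eq1: "h1 z + inverse (u1\<^sup>2) * g1 z = of_real (cmod (1 + a1)) * z / (1 - u1 * z)"
    if "norm z < 1" for z
    using e1 that unfolding b1_def[symmetric] inv u1_def[symmetric] by simp
  have eq2: "h2 z + inverse (u2\<^sup>2) * g2 z = of_real (cmod (1 + a2)) * z / (1 - u2 * z)"
    if "norm z < 1" for z
    using e2 that unfolding b2_def[symmetric] inv u2_def[symmetric] by simp
  have S: "in_S_H h1 g1" "in_S_H h2 g2" using f1 f2 by (auto simp: in_S_half_plane_def)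
  have inj: "inj_on ?f unit_disk"
    by (rule harm_conv_inj_and_segments(1)[OF S u c _ _ lu]) (use eq1 eq2 in auto)
  have segment: "closed_segment (?f z) (?f w) \<subseteq> ?f ` unit_disk"
    if "z \<in> unit_disk" "w \<in> unit_disk" "Im (u1 * u2 * ?f z) = Im (u1 * u2 * ?f w)" for z w
    by (rule harm_conv_inj_and_segments(2)[OF S u c _ _ lu that]) (use eq1 eq2 in auto)
  have dir: "- (\<gamma>1 + \<gamma>2 + Arg (1 + cnj a1) + Arg (1 + cnj a2)) = - (b1 + b2)"
    by (simp add: b1_def b2_def)
  \<comment> \<open>Multiplication by \<open>u1 * u2\<close> turns the direction
    \<open>-(b1 + b2)\<close> into the real axis, so the lines in question are level lines of
    \<open>Im (u1 * u2 * p)\<close>.\<close>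
  have u_exp: "u1 * u2 * exp (\<i> * of_real (- (b1 + b2))) = 1"
    by (simp add: u1_def u2_def exp_add[symmetric] algebra_simps)
  have "convex_in_direction (- (b1 + b2)) (?f ` unit_disk)"
    unfolding convex_in_direction_def
  proof (intro allI)
    fix v
    let ?l = "{v + of_real t * exp (\<i> * of_real (- (b1 + b2))) | t. True}"
    have Im_l: "Im (u1 * u2 * p) = Im (u1 * u2 * v)" if p: "p \<in> ?l" for p
    proof -
      obtain t where "p = v + of_real t * exp (\<i> * of_real (- (b1 + b2)))" using p by auto
      hence "u1 * u2 * p = u1 * u2 * v + of_real t * (u1 * u2 * exp (\<i> * of_real (- (b1 + b2))))"
        by (simp only: distrib_left mult_ac)
      thus ?thesis unfolding u_exp by simp
    qed
    have "convex ?l"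
    proof -
      have "?l = (\<lambda>t. v + t *\<^sub>R exp (\<i> * of_real (- (b1 + b2)))) ` UNIV"
        by (auto simp: scaleR_conv_of_real)
      also have "\<dots> = (+) v ` ((\<lambda>t. t *\<^sub>R exp (\<i> * of_real (- (b1 + b2)))) ` UNIV)"
        by (simp only: image_image)
      also have "convex \<dots>"
        by (intro convex_translation convex_linear_image convex_UNIV linearI)
           (simp_all add: scaleR_add_left)
      finally show ?thesis .
    qed
    thus "convex (?f ` unit_disk \<inter> ?l)"
      unfolding convex_contains_segment
    proof (intro ballI)
      fix p q assume l: "\<forall>a\<in>?l. \<forall>b\<in>?l. closed_segment a b \<subseteq> ?l"
        and pq: "p \<in> ?f ` unit_disk \<inter> ?l" "q \<in> ?f ` unit_disk \<inter> ?l"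
      obtain z w where zw: "z \<in> unit_disk" "w \<in> unit_disk" "p = ?f z" "q = ?f w"
        using pq by blast
      have "closed_segment p q \<subseteq> ?f ` unit_disk"
        using segment[OF zw(1,2)] Im_l[of p] Im_l[of q] pq zw(3,4) by simp
      thus "closed_segment p q \<subseteq> ?f ` unit_disk \<inter> ?l" using l pq by blast
    qed
  qed
  thus ?thesis using inj dir by simp
qed

end
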